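(* Let $0\le\mu\le 1$ and let $K$ be a centrally symmetric convex body in $\mathbb{R}^d$. Every pairwise intersecting Minkowski arrangement of order $\mu$ consisting of translates of $K$ contains at most $\left(1+\frac{2}{1+\mu}\right)^d$ elements.
   Context: A convex body is a compact convex set with non-empty interior. For $0\le\mu\le1$, the $\mu$-kernel of an $o$-symmetric convex body $K$ (symmetric about the origin $o$) is $\mu K$; for a homothetic copy $\lambda K+t$ ($\lambda>0$, $t\in\mathbb{R}^d$) the $\mu$-kernel is obtained by shrinking it about its center $t$ by the factor $\mu$, i.e. it is $\mu\lambda K+t$. The $\mu$-kernel of a translate of a body that is centrally symmetric about another point is defined likewise, by shrinking about its center. A family of positive homothetic copies (in particular, translates) of a centrally symmetric convex body is a pairwise intersecting Minkowski arrangement of order $\mu$ if any two members intersect and the interior of no member intersects the $\mu$-kernel of any other member. *)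

theory Defs
  imports "HOL-Analysis.Analysis"
begin

definition convex_body :: "(real ^ 'n) set \<Rightarrow> bool" where
  "convex_body K \<longleftrightarrow> compact K \<and> convex K \<and> interior K \<noteq> {}"

definition symmetric_about :: "real ^ 'n \<Rightarrow> (real ^ 'n) set \<Rightarrow> bool" where
  "symmetric_about c K \<longleftrightarrow> (\<forall>x\<in>K. 2 *\<^sub>R c - x \<in> K)"

definition centrally_symmetric :: "(real ^ 'n) set \<Rightarrow> bool" where
  "centrally_symmetric K \<longleftrightarrow> (\<exists>c. symmetric_about c K)"

text \<open>Well defined for nonempty compact centrally symmetric sets, see
  \<open>symmetric_about_unique\<close> below.\<close>

definition sym_center :: "(real ^ 'n) set \<Rightarrow> real ^ 'n" where
  "sym_center K = (THE c. symmetric_about c K)"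

definition mu_kernel :: "real \<Rightarrow> (real ^ 'n) set \<Rightarrow> (real ^ 'n) set" where
  "mu_kernel \<mu> K = (\<lambda>x. sym_center K + \<mu> *\<^sub>R (x - sym_center K)) ` K"

definition is_homothetic_copy :: "(real ^ 'n) set \<Rightarrow> (real ^ 'n) set \<Rightarrow> bool" where
  "is_homothetic_copy K S \<longleftrightarrow> (\<exists>r t. r > 0 \<and> S = (\<lambda>x. r *\<^sub>R x + t) ` K)"

definition is_translate :: "(real ^ 'n) set \<Rightarrow> (real ^ 'n) set \<Rightarrow> bool" where
  "is_translate K S \<longleftrightarrow> (\<exists>t. S = (\<lambda>x. x + t) ` K)"

text \<open>The order \<open>0 \<le> \<mu> \<le> 1\<close> and the requirement that \<open>K\<close> be a centrally symmetric convex
  body are not part of this predicate; they are to be assumed separately. Families are sets of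
  sets: an indexed family could not repeat a member, because the interior of a symmetric convex
  body contains its centre and hence meets its own kernel.\<close>

definition intersecting_Minkowski_arrangement ::
  "real \<Rightarrow> (real ^ 'n) set \<Rightarrow> (real ^ 'n) set set \<Rightarrow> bool" where
  "intersecting_Minkowski_arrangement \<mu> K F \<longleftrightarrow>
     (\<forall>S\<in>F. is_homothetic_copy K S) \<and>
     pairwise (\<lambda>S T. S \<inter> T \<noteq> {}) F \<and>
     pairwise (\<lambda>S T. interior S \<inter> mu_kernel \<mu> T = {}) F"

lemma symmetric_about_unique:
  assumes "compact K" "K \<noteq> {}" "symmetric_about c K" "symmetric_about c' K"
  shows "c = c'"
proof (rule ccontr)
  assume "c \<noteq> c'"
  define v where "v = c' - c"
  have "v \<bullet> v > 0" using \<open>c \<noteq> c'\<close> by (simp add: v_def)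
  have "continuous_on K (\<lambda>x. v \<bullet> x)" by (intro continuous_intros)
  then obtain x where x: "x \<in> K" "\<And>y. y \<in> K \<Longrightarrow> v \<bullet> y \<le> v \<bullet> x"
    using continuous_attains_sup[OF assms(1,2)] by blast
  have "2 *\<^sub>R c' - (2 *\<^sub>R c - x) \<in> K"
    using assms(3,4) x(1) unfolding symmetric_about_def by blast
  moreover have "2 *\<^sub>R c' - (2 *\<^sub>R c - x) = x + 2 *\<^sub>R v"
    by (simp add: v_def algebra_simps)
  ultimately have "v \<bullet> (x + 2 *\<^sub>R v) \<le> v \<bullet> x" using x(2) by metis
  with \<open>v \<bullet> v > 0\<close> show False
    by (simp only: inner_add_right inner_scaleR_right)
qed

lemma sym_center_eq:
  assumes "compact K" "K \<noteq> {}" "symmetric_about c K"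
  shows "sym_center K = c"
  unfolding sym_center_def
  using assms symmetric_about_unique by (intro the_equality) blast+

lemma symmetric_about_homothetic:
  assumes "symmetric_about c K"
  shows "symmetric_about (r *\<^sub>R c + t) ((\<lambda>x. r *\<^sub>R x + t) ` K)"
  unfolding symmetric_about_def
proof clarify
  fix x assume "x \<in> K"
  then have "2 *\<^sub>R c - x \<in> K" using assms by (simp add: symmetric_about_def)
  moreover have "2 *\<^sub>R (r *\<^sub>R c + t) - (r *\<^sub>R x + t) = r *\<^sub>R (2 *\<^sub>R c - x) + t"
    by (simp only: scaleR_2 scaleR_add_right scaleR_diff_right) simp
  ultimately show "2 *\<^sub>R (r *\<^sub>R c + t) - (r *\<^sub>R x + t) \<in> (\<lambda>x. r *\<^sub>R x + t) ` K"
    by (simp add: image_iff) blast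
qed

lemma mu_kernel_homothetic:
  assumes "compact K" "K \<noteq> {}" "symmetric_about 0 K"
  shows "mu_kernel \<mu> ((\<lambda>x. r *\<^sub>R x + t) ` K) = (\<lambda>x. (\<mu> * r) *\<^sub>R x + t) ` K"
proof -
  have "compact ((\<lambda>x. r *\<^sub>R x + t) ` K)"
    by (intro compact_continuous_image continuous_intros assms(1))
  then have "sym_center ((\<lambda>x. r *\<^sub>R x + t) ` K) = t"
    using symmetric_about_homothetic[OF assms(3), of r t] assms(2) by (intro sym_center_eq) auto
  then show ?thesis
    unfolding mu_kernel_def by (simp add: image_image add.commute)
qed

end

theory Submission
  imports Defs
begin

text \<open>Write \<open>K = K0 + p\<close> with \<open>K0\<close> symmetric about the origin, so that the members of \<open>F\<close> are
  \<open>K0 + t\<close> for \<open>t\<close> in a set \<open>T\<close>. Two members meet, so the differences of \<open>T\<close> lie in \<open>2 K0\<close>; the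
  kernel condition says that a difference of distinct points is not in \<open>(1 + \<mu>) int K0\<close>. In the
  norm with unit ball \<open>K0\<close>, \<open>T\<close> is thus a set of diameter at most \<open>\<beta> = 2\<close> whose points have distance
  at least \<open>\<alpha> = 1 + \<mu>\<close>.

  Then the bodies \<open>t + (\<alpha>/2) K0\<close> do not overlap, and their union \<open>A\<close> satisfies
  \<open>A - A \<subseteq> (\<alpha> + \<beta>) K0\<close>. The isodiametric inequality \<open>vol (A - A) \<ge> 2^d vol A\<close> (the case
  \<open>B = - A\<close> of the Brunn-Minkowski inequality) gives
  \<open>|T| \<alpha>^d vol K0 \<le> (\<alpha> + \<beta>)^d vol K0\<close>, which is the claim since
  \<open>(\<alpha> + \<beta>) / \<alpha> = 1 + 2 / (1 + \<mu>)\<close>.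

  The isodiametric inequality is proved and used in a discrete form,
  \<open>|A - A + {0,1}^d| \<ge> 2^d |A|\<close> for finite sets \<open>A\<close> of integer vectors
  (\<open>card_thick_difference\<close>). Pushing \<open>A\<close> together along the coordinate directions, one after the
  other, keeps \<open>|A|\<close> and does not increase the left-hand side; afterwards \<open>A\<close> and \<open>- A\<close> have become
  the same set, and the sums \<open>a + a + e\<close> with \<open>e \<in> {0,1}^d\<close> are distinct. To apply this, the
  picture is blown up by a factor \<open>R\<close> and the points of the body are replaced by
  the integer points that they contain (\<open>packing_at_scale\<close>). Their number is the volume up to an
  error of lower order (\<open>card_lattice_points_ge\<close>, \<open>card_lattice_points_le\<close>), which vanishes as
  \<open>R\<close> tends to infinity (\<open>packing_bound\<close>).\<close>

section \<open>A discrete isodiametric inequality\<close>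

definition set_coord :: "'n \<Rightarrow> 'a \<Rightarrow> 'a ^ 'n \<Rightarrow> 'a ^ 'n" where
  "set_coord i v x = (\<chi> j. if j = i then v else x $ j)"

definition fibre :: "'n \<Rightarrow> (int ^ 'n) set \<Rightarrow> int ^ 'n \<Rightarrow> int set" where
  "fibre i A x = {v. set_coord i v x \<in> A}"

text \<open>The discrete counterpart of Steiner symmetrization: on every line in direction \<open>i\<close>, a fibre
  with \<open>k\<close> points becomes \<open>{0, ..., k - 1}\<close>.\<close>

definition compress :: "'n \<Rightarrow> (int ^ 'n) set \<Rightarrow> (int ^ 'n) set" where
  "compress i A = {x. 0 \<le> x $ i \<and> x $ i < int (card (fibre i A x))}"

definition flip :: "'n set \<Rightarrow> int ^ 'n \<Rightarrow> int ^ 'n" where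
  "flip S x = (\<chi> j. if j \<in> S then - x $ j else x $ j)"

definition cube_vertices :: "(int ^ 'n) set" where
  "cube_vertices = {e. \<forall>i. e $ i \<in> {0, 1}}"

text \<open>If integer points stand for the unit cubes \<open>z + [0,1)^d\<close>, the cubes of \<open>thick_sum A B\<close> are
  those met by the Minkowski sum of the cubes of \<open>A\<close> and of \<open>B\<close>. Without the thickening the
  inequalities below would fail, already for \<open>d = 1\<close>.\<close>

definition thick_sum :: "(int ^ 'n) set \<Rightarrow> (int ^ 'n) set \<Rightarrow> (int ^ 'n) set" where
  "thick_sum A B = {a + b + e |a b e. a \<in> A \<and> b \<in> B \<and> e \<in> cube_vertices}"

lemma set_coord_nth [simp]: "set_coord i v x $ j = (if j = i then v else x $ j)"
  by (simp add: set_coord_def)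

lemma set_coord_set_coord [simp]: "set_coord i v (set_coord i w x) = set_coord i v x"
  by (simp add: vec_eq_iff)

lemma set_coord_same [simp]: "set_coord i (x $ i) x = x"
  by (simp add: vec_eq_iff)

lemma inj_set_coord: "inj (\<lambda>v. set_coord i v x)"
  by (rule injI) (metis set_coord_nth)

lemma fibre_set_coord [simp]: "fibre i A (set_coord i v x) = fibre i A x"
  by (simp add: fibre_def)

lemma flip_nth [simp]: "flip S x $ j = (if j \<in> S then - x $ j else x $ j)"
  by (simp add: flip_def)

lemma flip_flip [simp]: "flip S (flip S x) = x"
  by (simp add: vec_eq_iff)

lemma mem_flip_image: "x \<in> flip S ` A \<longleftrightarrow> flip S x \<in> A"
  by (metis flip_flip image_iff)

lemma finite_fibre: "finite A \<Longrightarrow> finite (fibre i A x)"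
  unfolding fibre_def
  using finite_vimageI[OF _ inj_set_coord, of A i x] by (simp add: vimage_def)

lemma card_cube_vertices: "card (cube_vertices :: (int ^ 'n) set) = 2 ^ CARD('n)"
proof -
  let ?f = "\<lambda>X :: 'n set. \<chi> i. if i \<in> X then 1 else (0::int)"
  have "bij_betw ?f (Pow UNIV) cube_vertices"
    by (rule bij_betw_byWitness[where f' = "\<lambda>e. {i. e $ i = 1}"])
       (auto simp: cube_vertices_def vec_eq_iff)
  then have "card (cube_vertices :: (int ^ 'n) set) = card (Pow (UNIV :: 'n set))"
    by (metis bij_betw_same_card)
  then show ?thesis by (simp add: card_Pow)
qed

lemma finite_cube_vertices: "finite (cube_vertices :: (int ^ 'n) set)"
  using card_cube_vertices by (metis card.infinite power_not_zero zero_neq_numeral)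

lemma finite_thick_sum:
  assumes "finite A" "finite B"
  shows "finite (thick_sum A B)"
proof -
  have "thick_sum A B \<subseteq> (\<lambda>(a, b, e). a + b + e) ` (A \<times> B \<times> cube_vertices)"
    by (force simp: thick_sum_def)
  then show ?thesis
    by (rule finite_subset) (simp add: assms finite_cube_vertices)
qed

text \<open>Both \<open>A\<close> and its compression are the disjoint unions of their fibres over the projection of
  \<open>A\<close> along direction \<open>i\<close>, and compression changes the fibres but not their sizes.\<close>

lemma compress_finite_card:
  fixes A :: "(int ^ 'n) set"
  assumes "finite A"
  shows "finite (compress i A) \<and> card (compress i A) = card A"
proof -
  \<comment> \<open>\<open>P\<close> is the projection of \<open>A\<close> to the hyperplane where coordinate \<open>i\<close> is 0, and \<open>L J\<close> is the
    set with fibre \<open>J x\<close> over \<open>x \<in> P\<close>.\<close>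
  define P where "P = set_coord i 0 ` A"
  define L where "L J = (\<Union>x\<in>P. (\<lambda>v. set_coord i v x) ` J x)" for J :: "int ^ 'n \<Rightarrow> int set"
  have P0: "x $ i = 0" if "x \<in> P" for x
    using that by (auto simp: P_def)
  have finP: "finite P" using assms by (simp add: P_def)
  have card_L: "finite (L J) \<and> card (L J) = (\<Sum>x\<in>P. card (J x))" if "\<And>x. finite (J x)" for J
  proof
    show "finite (L J)" using finP that by (simp add: L_def)
    have "card (L J) = (\<Sum>x\<in>P. card ((\<lambda>v. set_coord i v x) ` J x))"
      unfolding L_def
    proof (rule card_UN_disjoint[OF finP])
      show "\<forall>x\<in>P. finite ((\<lambda>v. set_coord i v x) ` J x)" using that by simp
      have "x = y" if "x \<in> P" "y \<in> P" "set_coord i v x = set_coord i w y" for x y v w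
        using P0[OF that(1)] P0[OF that(2)] that(3) by (metis set_coord_same set_coord_set_coord)
      then show "\<forall>x\<in>P. \<forall>y\<in>P. x \<noteq> y \<longrightarrow>
          (\<lambda>v. set_coord i v x) ` J x \<inter> (\<lambda>v. set_coord i v y) ` J y = {}"
        by blast
    qed
    also have "\<dots> = (\<Sum>x\<in>P. card (J x))"
      by (intro sum.cong refl card_image inj_on_subset[OF inj_set_coord]) simp
    finally show "card (L J) = (\<Sum>x\<in>P. card (J x))" .
  qed
  have A: "A = L (fibre i A)"
  proof (intro equalityI subsetI)
    fix x assume "x \<in> A"
    then have "x $ i \<in> fibre i A (set_coord i 0 x)" "set_coord i 0 x \<in> P"
      by (auto simp: fibre_def P_def)
    moreover have "x = set_coord i (x $ i) (set_coord i 0 x)" by simp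
    ultimately show "x \<in> L (fibre i A)" unfolding L_def by blast
  next
    fix x assume "x \<in> L (fibre i A)"
    then show "x \<in> A" by (auto simp: L_def fibre_def)
  qed
  have C: "compress i A = L (\<lambda>x. {0..<int (card (fibre i A x))})"
  proof (intro equalityI subsetI)
    fix x assume x: "x \<in> compress i A"
    then have "fibre i A x \<noteq> {}" by (auto simp: compress_def)
    then obtain v where "set_coord i v x \<in> A" by (auto simp: fibre_def)
    then have "set_coord i 0 x \<in> P"
      unfolding P_def by (metis image_eqI set_coord_set_coord)
    moreover have "x $ i \<in> {0..<int (card (fibre i A (set_coord i 0 x)))}"
      using x by (simp add: compress_def)
    moreover have "x = set_coord i (x $ i) (set_coord i 0 x)" by simp
    ultimately show "x \<in> L (\<lambda>x. {0..<int (card (fibre i A x))})" unfolding L_def by blast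
  next
    fix x assume "x \<in> L (\<lambda>x. {0..<int (card (fibre i A x))})"
    then show "x \<in> compress i A" by (auto simp: L_def compress_def)
  qed
  show ?thesis
    using card_L[of "fibre i A"] card_L[of "\<lambda>x. {0..<int (card (fibre i A x))}"]
      A C finite_fibre[OF assms] by simp
qed

text \<open>The translate of \<open>U\<close> by \<open>min V\<close> and the translate of \<open>V\<close> by \<open>max U + 1\<close> both lie in
  \<open>U + V + {0, 1}\<close>, and the first lies to the left of the second.\<close>

lemma card_int_thick_sum:
  fixes U V :: "int set"
  assumes "finite U" "finite V" "U \<noteq> {}" "V \<noteq> {}"
    and "finite W" and W: "\<And>u v e. u \<in> U \<Longrightarrow> v \<in> V \<Longrightarrow> e \<in> {0, 1} \<Longrightarrow> u + v + e \<in> W"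
  shows "card U + card V \<le> card W"
proof -
  let ?X = "(\<lambda>u. u + Min V) ` U" and ?Y = "(\<lambda>v. Max U + v + 1) ` V"
  have "?X \<inter> ?Y = {}"
  proof -
    have "u + Min V < Max U + v + 1" if "u \<in> U" "v \<in> V" for u v
      using Max_ge[OF assms(1) that(1)] Min_le[OF assms(2) that(2)] by simp
    then show ?thesis by (fastforce simp: image_iff)
  qed
  then have "card (?X \<union> ?Y) = card ?X + card ?Y"
    using assms by (intro card_Un_disjoint) auto
  also have "\<dots> = card U + card V" by (simp add: card_image inj_on_def)
  finally have "card U + card V = card (?X \<union> ?Y)" by simp
  also have "\<dots> \<le> card W"
  proof (rule card_mono[OF \<open>finite W\<close>])
    have "?X \<subseteq> W" using W[of _ "Min V" 0] Min_in[OF assms(2,4)] by auto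
    moreover have "?Y \<subseteq> W" using W[of "Max U" _ 1] Max_in[OF assms(1,3)] by auto
    ultimately show "?X \<union> ?Y \<subseteq> W" by simp
  qed
  finally show ?thesis .
qed

text \<open>Compression does not increase thick sums. Along a line, the fibres \<open>{0, ..., k - 1}\<close> and
  \<open>{0, ..., l - 1}\<close> have a thick sum ending at \<open>k + l - 1\<close>, and by \<open>card_int_thick_sum\<close> the fibre of
  the original thick sum has at least \<open>k + l\<close> points.\<close>

lemma thick_sum_compress:
  assumes "finite A" "finite B"
  shows "thick_sum (compress i A) (compress i B) \<subseteq> compress i (thick_sum A B)"
proof
  fix z assume "z \<in> thick_sum (compress i A) (compress i B)"
  then obtain a b e where z: "z = a + b + e"
    and a: "a \<in> compress i A" and b: "b \<in> compress i B" and e: "e \<in> cube_vertices"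
    by (auto simp: thick_sum_def)
  have ei: "0 \<le> e $ i" "e $ i \<le> 1"
    using e by (auto simp: cube_vertices_def dest: spec[of _ i])
  have "card (fibre i A a) + card (fibre i B b) \<le> card (fibre i (thick_sum A B) z)"
  proof (rule card_int_thick_sum)
    show "finite (fibre i (thick_sum A B) z)"
      using assms by (intro finite_fibre finite_thick_sum)
    fix u v w :: int
    assume "u \<in> fibre i A a" "v \<in> fibre i B b" "w \<in> {0, 1}"
    moreover from this have "set_coord i w e \<in> cube_vertices"
      using e by (auto simp: cube_vertices_def)
    moreover have "set_coord i (u + v + w) z
        = set_coord i u a + set_coord i v b + set_coord i w e"
      by (simp add: z vec_eq_iff)
    ultimately show "u + v + w \<in> fibre i (thick_sum A B) z"
      unfolding fibre_def thick_sum_def by blast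
  qed (use assms a b in \<open>auto simp: finite_fibre compress_def\<close>)
  then show "z \<in> compress i (thick_sum A B)"
    using a b ei by (auto simp: compress_def z)
qed

lemma card_fibre_flip: "card (fibre i (flip S ` A) x) = card (fibre i A (flip (S - {i}) x))"
proof -
  have *: "flip S (set_coord i v x) = set_coord i (if i \<in> S then - v else v) (flip (S - {i}) x)" for v
    by (simp add: vec_eq_iff)
  have "bij_betw (\<lambda>v. if i \<in> S then - v else v) (fibre i (flip S ` A) x)
          (fibre i A (flip (S - {i}) x))"
    by (rule bij_betw_byWitness[where f' = "\<lambda>v. if i \<in> S then - v else v"])
       (auto simp: fibre_def mem_flip_image *)
  then show ?thesis by (rule bij_betw_same_card)
qed

text \<open>A compressed set remembers only the sizes of the fibres, so reflecting the coordinate of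
  compression leaves no trace; the other reflections commute with compression.\<close>

lemma compress_flip: "compress i (flip S ` A) = flip (S - {i}) ` compress i A"
  by (auto simp: compress_def mem_flip_image card_fibre_flip)

text \<open>The vectors \<open>a + a + e\<close> are distinct: the parities of the coordinates determine \<open>e\<close>.\<close>

lemma card_thick_sum_self:
  fixes A :: "(int ^ 'n) set"
  assumes "finite A"
  shows "2 ^ CARD('n) * card A \<le> card (thick_sum A A)"
proof -
  let ?f = "\<lambda>(a, e). a + a + e :: int ^ 'n"
  have "inj_on ?f (A \<times> cube_vertices)"
  proof (rule inj_onI)
    fix p q :: "(int ^ 'n) \<times> (int ^ 'n)"
    assume "p \<in> A \<times> cube_vertices" "q \<in> A \<times> cube_vertices" and f: "?f p = ?f q"
    then obtain a e a' e' where p: "p = (a, e)" and q: "q = (a', e')"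
      and e: "e \<in> cube_vertices" "e' \<in> cube_vertices" by blast
    have eq: "a + a + e = a' + a' + e'" using f by (simp only: p q prod.case)
    have "a $ j = a' $ j \<and> e $ j = e' $ j" for j
    proof -
      have "a $ j + a $ j + e $ j = a' $ j + a' $ j + e' $ j"
        using eq by (metis vector_add_component)
      moreover have "e $ j \<in> {0, 1}" "e' $ j \<in> {0, 1}"
        using e by (simp_all add: cube_vertices_def)
      ultimately show ?thesis by auto presburger+
    qed
    then show "p = q" by (simp add: p q vec_eq_iff)
  qed
  then have "card A * 2 ^ CARD('n) = card (?f ` (A \<times> cube_vertices))"
    by (simp add: card_image card_cartesian_product card_cube_vertices)
  also have "\<dots> \<le> card (thick_sum A A)"
    by (rule card_mono[OF finite_thick_sum[OF assms assms]]) (force simp: thick_sum_def)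
  finally show ?thesis by (simp add: mult.commute)
qed

text \<open>Induction on the set of reflected coordinates. To remove \<open>i\<close> from it, compress both sets in
  direction \<open>i\<close>: cardinalities stay the same, the thick sum does not grow, and by \<open>compress_flip\<close>
  the second compressed set is the reflection of the first one in the remaining coordinates. This
  is why partial reflections are needed for a statement about \<open>A\<close> and \<open>- A\<close>.\<close>

lemma card_thick_sum_flip:
  fixes A :: "(int ^ 'n) set"
  assumes "finite A"
  shows "2 ^ CARD('n) * card A \<le> card (thick_sum A (flip S ` A))"
proof -
  have "finite S" by simp
  then show ?thesis
    using assms
  proof (induction S arbitrary: A rule: finite_induct)
    case empty
    have "flip {} = (id :: int ^ 'n \<Rightarrow> _)" by (simp add: fun_eq_iff vec_eq_iff)
    then show ?case using card_thick_sum_self[OF empty] by simp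
  next
    case (insert i S)
    let ?B = "flip (insert i S) ` A"
    have fB: "finite ?B" using insert.prems by simp
    have "2 ^ CARD('n) * card A = 2 ^ CARD('n) * card (compress i A)"
      using compress_finite_card[OF insert.prems] by simp
    also have "\<dots> \<le> card (thick_sum (compress i A) (flip S ` compress i A))"
      using insert.IH compress_finite_card[OF insert.prems] by blast
    also have "flip S ` compress i A = compress i ?B"
      using insert.hyps by (simp add: compress_flip)
    also have "card (thick_sum (compress i A) (compress i ?B)) \<le> card (compress i (thick_sum A ?B))"
      using compress_finite_card[OF finite_thick_sum[OF insert.prems fB]]
        thick_sum_compress[OF insert.prems fB] by (intro card_mono) simp_all
    also have "\<dots> = card (thick_sum A ?B)"
      using compress_finite_card[OF finite_thick_sum[OF insert.prems fB]] by simp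
    finally show ?case .
  qed
qed

lemma card_thick_difference:
  fixes A :: "(int ^ 'n) set"
  assumes "finite A"
  shows "2 ^ CARD('n) * card A \<le> card (thick_sum A (uminus ` A))"
proof -
  have "flip UNIV = (uminus :: int ^ 'n \<Rightarrow> _)" by (simp add: fun_eq_iff vec_eq_iff)
  then show ?thesis using card_thick_sum_flip[OF assms, of UNIV] by simp
qed

section \<open>Integer points in dilates of a symmetric convex body\<close>

definition real_vec :: "int ^ 'n \<Rightarrow> real ^ 'n" where
  "real_vec z = (\<chi> i. real_of_int (z $ i))"

definition floor_vec :: "real ^ 'n \<Rightarrow> int ^ 'n" where
  "floor_vec x = (\<chi> i. \<lfloor>x $ i\<rfloor>)"

lemma real_vec_nth [simp]: "real_vec z $ i = real_of_int (z $ i)"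
  by (simp add: real_vec_def)

lemma floor_vec_nth [simp]: "floor_vec x $ i = \<lfloor>x $ i\<rfloor>"
  by (simp add: floor_vec_def)

lemma real_vec_add: "real_vec (x + y) = real_vec x + real_vec y"
  and real_vec_diff: "real_vec (x - y) = real_vec x - real_vec y"
  by (simp_all add: vec_eq_iff)

lemma finite_vec_bounded:
  fixes m :: int
  shows "finite {z :: int ^ 'n. \<forall>i. z $ i \<in> {- m..m}}"
proof (rule finite_imageD)
  have "vec_nth ` {z :: int ^ 'n. \<forall>i. z $ i \<in> {- m..m}} \<subseteq> PiE UNIV (\<lambda>_. {- m..m})"
    by auto
  then show "finite (vec_nth ` {z :: int ^ 'n. \<forall>i. z $ i \<in> {- m..m}})"
    by (rule finite_subset) (auto intro: finite_PiE)
  show "inj_on vec_nth {z :: int ^ 'n. \<forall>i. z $ i \<in> {- m..m}}"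
    by (auto simp: inj_on_def vec_nth_inject)
qed

lemma finite_lattice_points_bounded:
  assumes "bounded S"
  shows "finite {z. real_vec z \<in> S}"
proof -
  obtain B where B: "\<And>x. x \<in> S \<Longrightarrow> norm x \<le> B" using assms by (auto simp: bounded_iff)
  have "z $ i \<in> {- \<lceil>B\<rceil>..\<lceil>B\<rceil>}" if "real_vec z \<in> S" for z i
  proof -
    have "\<bar>real_of_int (z $ i)\<bar> \<le> B"
      using component_le_norm_cart[of "real_vec z" i] B[OF that] by simp
    also have "B \<le> real_of_int \<lceil>B\<rceil>" by (rule le_of_int_ceiling)
    finally have "\<bar>z $ i\<bar> \<le> \<lceil>B\<rceil>" by linarith
    then show ?thesis by auto
  qed
  then show ?thesis by (intro finite_subset[OF _ finite_vec_bounded[of "\<lceil>B\<rceil>"]]) blast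
qed

lemma measure_unit_cbox: "measure lebesgue (cbox a (a + 1 :: real ^ 'n)) = 1"
proof -
  have "cbox a (a + 1) \<noteq> {}" by (simp add: interval_ne_empty_cart)
  then show ?thesis by (simp add: content_cbox_cart)
qed

lemma measure_unit_box: "measure lebesgue (box a (a + 1 :: real ^ 'n)) = 1"
proof -
  have "measure lebesgue (box a (a + 1)) = measure lebesgue (cbox a (a + 1))"
    by (simp add: measure_def emeasure_lborel_box_eq emeasure_lborel_cbox_eq)
  then show ?thesis by (simp only: measure_unit_cbox)
qed

text \<open>The number \<open>c\<close> bounds, in the norm with unit ball \<open>K\<close>, all vectors with coordinates in
  \<open>[-1, 1]\<close>. Every rounding to integer vectors costs at most a summand in \<open>c K\<close>. The cube condition
  also makes the origin an interior point of \<open>K\<close>.\<close>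

locale o_symmetric_body =
  fixes K :: "(real ^ 'n) set" and c :: real
  assumes compact_K: "compact K" and convex_K: "convex K"
    and minus_K: "x \<in> K \<Longrightarrow> - x \<in> K"
    and c_pos: "0 < c"
    and cube_in_cK: "(\<And>i. \<bar>v $ i\<bar> \<le> 1) \<Longrightarrow> v \<in> (*\<^sub>R) c ` K"
begin

abbreviation dil :: "real \<Rightarrow> (real ^ 'n) set" where
  "dil r \<equiv> (*\<^sub>R) r ` K"

definition V :: real where "V = measure lebesgue K"

definition lattice_points :: "real \<Rightarrow> (int ^ 'n) set" where
  "lattice_points r = {z. real_vec z \<in> dil r}"

lemma zero_in_K: "0 \<in> K"
  using cube_in_cK[of 0] c_pos by auto

lemma zero_interior: "0 \<in> interior K"
proof (rule interiorI)
  show "open (ball 0 (1 / c) :: (real ^ 'n) set)" by simp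
  show "0 \<in> ball 0 (1 / c)" using c_pos by simp
  show "ball 0 (1 / c) \<subseteq> K"
  proof
    fix x :: "real ^ 'n" assume "x \<in> ball 0 (1 / c)"
    then have "norm (c *\<^sub>R x) \<le> 1" using c_pos by (simp add: field_simps)
    then have "c *\<^sub>R x \<in> (*\<^sub>R) c ` K"
      by (intro cube_in_cK) (meson component_le_norm_cart order_trans)
    then show "x \<in> K" using c_pos by auto
  qed
qed

lemma dil_minus: "x \<in> dil r \<Longrightarrow> - x \<in> dil r"
  using minus_K by (force simp: image_iff)

lemma dil_add:
  assumes "x \<in> dil r" "y \<in> dil s" "0 \<le> r" "0 \<le> s"
  shows "x + y \<in> dil (r + s)"
proof (cases "r + s = 0")
  case True
  then have "r = 0" "s = 0" using assms by auto
  then show ?thesis using assms by auto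
next
  case False
  obtain k l where k: "k \<in> K" "x = r *\<^sub>R k" and l: "l \<in> K" "y = s *\<^sub>R l"
    using assms by blast
  have "(r / (r + s)) *\<^sub>R k + (s / (r + s)) *\<^sub>R l \<in> K"
    using assms(3,4) False
    by (intro convexD[OF convex_K k(1) l(1)]) (auto simp: add_divide_distrib[symmetric])
  moreover have "x + y = (r + s) *\<^sub>R ((r / (r + s)) *\<^sub>R k + (s / (r + s)) *\<^sub>R l)"
    using False by (simp add: k l scaleR_add_right)
  ultimately show ?thesis by blast
qed

lemma dil_diff: "x \<in> dil r \<Longrightarrow> y \<in> dil s \<Longrightarrow> 0 \<le> r \<Longrightarrow> 0 \<le> s \<Longrightarrow> x - y \<in> dil (r + s)"
  using dil_add[of x r "- y" s] dil_minus[of y s] by simp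

lemma lmeasurable_dil: "dil r \<in> lmeasurable"
  by (intro lmeasurable_compact compact_scaling compact_K)

lemma measure_dil: "0 \<le> r \<Longrightarrow> measure lebesgue (dil r) = r ^ CARD('n) * V"
  using measure_lebesgue_affine[of r 0 K] by (simp add: V_def)

lemma finite_lattice_points: "finite (lattice_points r)"
  unfolding lattice_points_def
  by (intro finite_lattice_points_bounded compact_imp_bounded compact_scaling compact_K)

lemma floor_error: "x - real_vec (floor_vec x) \<in> dil c"
  by (rule cube_in_cK) (simp add: abs_le_iff, linarith)

text \<open>The unit cube is contained in \<open>c K\<close>.\<close>

lemma V_pos: "0 < V"
proof -
  have "cbox 0 (0 + 1) \<subseteq> dil c"
    by (intro subsetI cube_in_cK) (force simp: mem_box_cart abs_le_iff intro: order_trans)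
  then have "measure lebesgue (cbox 0 (0 + 1 :: real ^ 'n)) \<le> measure lebesgue (dil c)"
    by (intro measure_mono_fmeasurable lmeasurable_dil) auto
  then have "1 \<le> c ^ CARD('n) * V"
    using c_pos by (simp only: measure_unit_cbox measure_dil less_imp_le)
  then show ?thesis
    using c_pos zero_less_mult_pos[of "c ^ CARD('n)" V] by simp
qed

text \<open>Each point of \<open>(r - c) K\<close> lies in the unit cube above its coordinatewise floor, and that
  integer vector lies in \<open>r K\<close>.\<close>

lemma card_lattice_points_ge:
  assumes "c \<le> r"
  shows "(r - c) ^ CARD('n) * V \<le> card (lattice_points r)"
proof -
  have "dil (r - c) \<subseteq> (\<Union>z\<in>lattice_points r. cbox (real_vec z) (real_vec z + 1))"
  proof
    fix x assume "x \<in> dil (r - c)"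
    then have "x - (x - real_vec (floor_vec x)) \<in> dil ((r - c) + c)"
      using floor_error c_pos assms by (intro dil_diff) auto
    then have "floor_vec x \<in> lattice_points r" by (simp add: lattice_points_def)
    moreover have "x \<in> cbox (real_vec (floor_vec x)) (real_vec (floor_vec x) + 1)"
      by (auto simp: mem_box_cart)
    ultimately show "x \<in> (\<Union>z\<in>lattice_points r. cbox (real_vec z) (real_vec z + 1))" by blast
  qed
  then have "measure lebesgue (dil (r - c))
      \<le> measure lebesgue (\<Union>z\<in>lattice_points r. cbox (real_vec z) (real_vec z + 1))"
    by (intro measure_mono_fmeasurable fmeasurable.finite_UN finite_lattice_points
        fmeasurableD[OF lmeasurable_dil]) auto
  also have "\<dots> \<le> (\<Sum>z\<in>lattice_points r. measure lebesgue (cbox (real_vec z) (real_vec z + 1)))"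
    by (intro measure_UNION_le finite_lattice_points) auto
  also have "\<dots> = card (lattice_points r)" by (simp only: measure_unit_cbox) simp
  finally show ?thesis using assms by (simp add: measure_dil)
qed

text \<open>The open unit cubes above the integer points of \<open>r K\<close> are disjoint and stay inside
  \<open>(r + c) K\<close>.\<close>

lemma card_lattice_points_le:
  assumes "0 \<le> r"
  shows "card (lattice_points r) \<le> (r + c) ^ CARD('n) * V"
proof -
  have disj: "disjoint_family_on (\<lambda>z. box (real_vec z) (real_vec z + 1)) (lattice_points r)"
  proof -
    have "z = w" if "x \<in> box (real_vec z) (real_vec z + 1)"
      "x \<in> box (real_vec w) (real_vec w + 1)" for x z w
    proof -
      have "z $ i = w $ i" for i
      proof -
        have "real_of_int (z $ i) < x $ i" "x $ i < real_of_int (z $ i) + 1"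
          "real_of_int (w $ i) < x $ i" "x $ i < real_of_int (w $ i) + 1"
          using that by (auto simp: mem_box_cart)
        then show ?thesis by linarith
      qed
      then show ?thesis by (simp add: vec_eq_iff)
    qed
    then show ?thesis unfolding disjoint_family_on_def by blast
  qed
  have "real (card (lattice_points r))
      = (\<Sum>z\<in>lattice_points r. measure lebesgue (box (real_vec z) (real_vec z + 1)))"
    by (simp only: measure_unit_box) simp
  also have "\<dots> = measure lebesgue (\<Union>z\<in>lattice_points r. box (real_vec z) (real_vec z + 1))"
    by (intro measure_finite_Union[symmetric] finite_lattice_points disj)
       (auto simp: emeasure_lborel_box_eq)
  also have "\<dots> \<le> measure lebesgue (dil (r + c))"
  proof (intro measure_mono_fmeasurable lmeasurable_dil)
    show "(\<Union>z\<in>lattice_points r. box (real_vec z) (real_vec z + 1)) \<subseteq> dil (r + c)"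
    proof clarify
      fix z x assume z: "z \<in> lattice_points r" and x: "x \<in> box (real_vec z) (real_vec z + 1)"
      have "\<bar>(x - real_vec z) $ i\<bar> \<le> 1" for i
        using x by (simp add: mem_box_cart abs_le_iff) (smt (verit))
      then have "x - real_vec z \<in> dil c" by (rule cube_in_cK)
      then have "real_vec z + (x - real_vec z) \<in> dil (r + c)"
        using z assms c_pos by (intro dil_add) (auto simp: lattice_points_def)
      then show "x \<in> dil (r + c)" by simp
    qed
    show "(\<Union>z\<in>lattice_points r. box (real_vec z) (real_vec z + 1)) \<in> sets lebesgue"
      by (intro sets.finite_UN finite_lattice_points) auto
  qed
  finally show ?thesis using assms c_pos by (simp add: measure_dil)
qed

section \<open>Separated sets of bounded diameter\<close>

text \<open>Round the points \<open>R t\<close> to integer vectors \<open>z t\<close> and surround each of them by the integer points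
  of \<open>q K\<close>. The radius \<open>q\<close> is \<open>\<alpha> R / 2\<close> diminished by \<open>c\<close>: this leaves \<open>2 c\<close> of room, which makes
  the clusters disjoint in spite of the rounding errors, and which also absorbs the rounding error
  and the cube vertex in the thick difference set, so that this set stays inside \<open>(\<alpha> + \<beta>) R K\<close>.\<close>

lemma packing_at_scale:
  fixes \<alpha> \<beta> R :: real
  assumes T: "finite T" and R: "0 < R" and "0 < \<alpha>" "0 \<le> \<beta>" and R_large: "4 * c \<le> \<alpha> * R"
    and near: "\<And>s t. s \<in> T \<Longrightarrow> t \<in> T \<Longrightarrow> s - t \<in> dil \<beta>"
    and far: "\<And>s t. s \<in> T \<Longrightarrow> t \<in> T \<Longrightarrow> s \<noteq> t \<Longrightarrow> s - t \<notin> (*\<^sub>R) \<alpha> ` interior K"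
  shows "card T * (\<alpha> * R - 4 * c) ^ CARD('n) \<le> ((\<alpha> + \<beta>) * R + c) ^ CARD('n)"
proof -
  define q where "q = \<alpha> * R / 2 - c"
  have q: "c \<le> q" "0 \<le> q" using R_large c_pos by (auto simp: q_def)
  define z where "z t = floor_vec (R *\<^sub>R t)" for t :: "real ^ 'n"
  define err where "err t = R *\<^sub>R t - real_vec (z t)" for t
  define A where "A = (\<Union>t\<in>T. (\<lambda>x. z t + x) ` lattice_points q)"
  have z_eq: "real_vec (z t) = R *\<^sub>R t - err t" for t by (simp add: err_def)
  have err_diff: "err s - err t \<in> dil c" for s t
  proof (rule cube_in_cK)
    fix i
    have "0 \<le> err u $ i \<and> err u $ i < 1" for u
      by (simp add: err_def z_def) linarith
    from this[of s] this[of t] show "\<bar>(err s - err t) $ i\<bar> \<le> 1" by (simp add: abs_le_iff)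
  qed
  have finA: "finite A" using T finite_lattice_points by (simp add: A_def)
  have "card A = (\<Sum>t\<in>T. card ((\<lambda>x. z t + x) ` lattice_points q))"
    unfolding A_def
  proof (rule card_UN_disjoint[OF T])
    show "\<forall>t\<in>T. finite ((\<lambda>x. z t + x) ` lattice_points q)"
      using finite_lattice_points by simp
    have "s = t" if st: "s \<in> T" "t \<in> T" and xy: "x \<in> lattice_points q" "y \<in> lattice_points q"
      and eq: "z s + x = z t + y" for s t x y
    proof (rule ccontr)
      assume "s \<noteq> t"
      have "real_vec (z s) + real_vec x = real_vec (z t) + real_vec y"
        using eq by (metis real_vec_add)
      then have "R *\<^sub>R (s - t) = (real_vec y - real_vec x) + (err s - err t)"
        by (simp add: z_eq algebra_simps)
      also have "\<dots> \<in> dil ((q + q) + c)"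
        using xy q c_pos err_diff by (intro dil_add dil_diff) (auto simp: lattice_points_def)
      finally obtain k where k: "k \<in> K" "R *\<^sub>R (s - t) = (q + q + c) *\<^sub>R k" by blast
      \<comment> \<open>Here \<open>q + q + c = \<alpha> R - c = \<alpha> R (1 - e)\<close>, and shrinking by \<open>1 - e\<close> moves \<open>k\<close> into the
        interior.\<close>
      define e where "e = c / (\<alpha> * R)"
      have e: "0 < e" "e \<le> 1"
        using R_large c_pos R \<open>0 < \<alpha>\<close> by (auto simp: e_def divide_simps)
      have "k - e *\<^sub>R (k - 0) \<in> interior K"
        by (rule mem_interior_convex_shrink[OF convex_K zero_interior k(1) e])
      moreover have "s - t = \<alpha> *\<^sub>R (k - e *\<^sub>R (k - 0))"
      proof -
        have "R *\<^sub>R (s - t) = R *\<^sub>R (\<alpha> *\<^sub>R (k - e *\<^sub>R (k - 0)))"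
          using k(2) R \<open>0 < \<alpha>\<close>
          by (simp add: q_def e_def scaleR_diff_right scaleR_diff_left[symmetric] field_simps)
        then show ?thesis using R by (metis less_irrefl scaleR_left_imp_eq)
      qed
      ultimately have "s - t \<in> (*\<^sub>R) \<alpha> ` interior K" by blast
      then show False using far[OF st \<open>s \<noteq> t\<close>] by blast
    qed
    then show "\<forall>s\<in>T. \<forall>t\<in>T. s \<noteq> t \<longrightarrow>
        (\<lambda>x. z s + x) ` lattice_points q \<inter> (\<lambda>x. z t + x) ` lattice_points q = {}"
      by blast
  qed
  also have "\<dots> = card T * card (lattice_points q)"
    by (simp add: card_image)
  finally have cardA: "card A = card T * card (lattice_points q)" .
  have "thick_sum A (uminus ` A) \<subseteq> lattice_points ((\<alpha> + \<beta>) * R)"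
  proof
    fix w assume "w \<in> thick_sum A (uminus ` A)"
    then obtain a b e where w: "w = a + - b + e" and ab: "a \<in> A" "b \<in> A"
      and e: "e \<in> cube_vertices" by (auto simp: thick_sum_def)
    obtain s x where a: "s \<in> T" "x \<in> lattice_points q" "a = z s + x"
      using ab(1) by (auto simp: A_def)
    obtain t y where b: "t \<in> T" "y \<in> lattice_points q" "b = z t + y"
      using ab(2) by (auto simp: A_def)
    have ec: "real_vec e \<in> dil c"
    proof (rule cube_in_cK)
      fix i
      show "\<bar>real_vec e $ i\<bar> \<le> 1" using e by (auto simp: cube_vertices_def dest: spec[of _ i])
    qed
    have R_near: "R *\<^sub>R (s - t) \<in> dil (R * \<beta>)"
    proof -
      obtain k where "k \<in> K" "s - t = \<beta> *\<^sub>R k" using near[OF a(1) b(1)] by blast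
      then show ?thesis by (metis image_eqI scaleR_scaleR)
    qed
    have "real_vec w = R *\<^sub>R (s - t) + (real_vec x - real_vec y) + (err t - err s) + real_vec e"
      by (simp only: w a b diff_conv_add_uminus[symmetric] real_vec_add real_vec_diff z_eq)
         (simp add: algebra_simps)
    also have "\<dots> \<in> dil (R * \<beta> + (q + q) + c + c)"
      using R_near ec err_diff[of t s] a(2) b(2) q c_pos R \<open>0 \<le> \<beta>\<close>
      by (intro dil_add dil_diff) (auto simp: lattice_points_def)
    also have "R * \<beta> + (q + q) + c + c = (\<alpha> + \<beta>) * R"
      by (simp add: q_def algebra_simps)
    finally show "w \<in> lattice_points ((\<alpha> + \<beta>) * R)" by (simp add: lattice_points_def)
  qed
  then have "card (thick_sum A (uminus ` A)) \<le> card (lattice_points ((\<alpha> + \<beta>) * R))"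
    by (intro card_mono finite_lattice_points)
  with card_thick_difference[OF finA]
  have "2 ^ CARD('n) * (card T * card (lattice_points q)) \<le> card (lattice_points ((\<alpha> + \<beta>) * R))"
    by (simp only: cardA)
  then have count: "2 ^ CARD('n) * (real (card T) * card (lattice_points q))
      \<le> card (lattice_points ((\<alpha> + \<beta>) * R))"
    by (metis of_nat_le_iff of_nat_mult of_nat_numeral of_nat_power)
  have "card T * (\<alpha> * R - 4 * c) ^ CARD('n) * V
      = 2 ^ CARD('n) * (card T * ((q - c) ^ CARD('n) * V))"
  proof -
    have "\<alpha> * R - 4 * c = 2 * (q - c)" by (simp add: q_def)
    then show ?thesis by (simp only: power_mult_distrib) (simp add: mult_ac)
  qed
  also have "\<dots> \<le> 2 ^ CARD('n) * (real (card T) * card (lattice_points q))"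
    by (intro mult_left_mono card_lattice_points_ge q(1)) auto
  also note count
  also have "real (card (lattice_points ((\<alpha> + \<beta>) * R))) \<le> ((\<alpha> + \<beta>) * R + c) ^ CARD('n) * V"
    using R \<open>0 < \<alpha>\<close> \<open>0 \<le> \<beta>\<close> by (intro card_lattice_points_le) auto
  finally show ?thesis using V_pos by simp
qed

text \<open>Divide \<open>packing_at_scale\<close> by \<open>R^d\<close> and let \<open>R\<close> tend to infinity.\<close>

lemma packing_bound:
  fixes \<alpha> \<beta> :: real
  assumes T: "finite T" and "0 < \<alpha>" "0 \<le> \<beta>"
    and near: "\<And>s t. s \<in> T \<Longrightarrow> t \<in> T \<Longrightarrow> s - t \<in> dil \<beta>"
    and far: "\<And>s t. s \<in> T \<Longrightarrow> t \<in> T \<Longrightarrow> s \<noteq> t \<Longrightarrow> s - t \<notin> (*\<^sub>R) \<alpha> ` interior K"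
  shows "card T * \<alpha> ^ CARD('n) \<le> (\<alpha> + \<beta>) ^ CARD('n)"
proof (rule tendsto_le)
  have vanish: "((\<lambda>R. a / R) \<longlongrightarrow> 0) at_top" for a :: real
    by (intro tendsto_divide_0[OF tendsto_const] filterlim_at_top_imp_at_infinity filterlim_ident)
  show "((\<lambda>R. card T * (\<alpha> - 4 * c / R) ^ CARD('n)) \<longlongrightarrow> card T * \<alpha> ^ CARD('n)) at_top"
    using tendsto_mult[OF tendsto_const tendsto_power[OF tendsto_diff[OF tendsto_const vanish]]]
    by simp
  show "((\<lambda>R. (\<alpha> + \<beta> + c / R) ^ CARD('n)) \<longlongrightarrow> (\<alpha> + \<beta>) ^ CARD('n)) at_top"
    using tendsto_power[OF tendsto_add[OF tendsto_const vanish]] by simp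
  show "\<forall>\<^sub>F R in at_top. card T * (\<alpha> - 4 * c / R) ^ CARD('n) \<le> (\<alpha> + \<beta> + c / R) ^ CARD('n)"
    using eventually_gt_at_top[of 0] eventually_ge_at_top[of "4 * c / \<alpha>"]
  proof eventually_elim
    case (elim R)
    then have "4 * c \<le> \<alpha> * R" using \<open>0 < \<alpha>\<close> by (simp add: field_simps)
    then have le: "card T * (\<alpha> * R - 4 * c) ^ CARD('n) \<le> ((\<alpha> + \<beta>) * R + c) ^ CARD('n)"
      using packing_at_scale[OF T elim(1) assms(2,3) _ near far] by blast
    have eq: "\<alpha> * R - 4 * c = R * (\<alpha> - 4 * c / R)" "(\<alpha> + \<beta>) * R + c = R * (\<alpha> + \<beta> + c / R)"
      using elim(1) by (simp_all add: field_simps)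
    have "R ^ CARD('n) * (card T * (\<alpha> - 4 * c / R) ^ CARD('n))
        \<le> R ^ CARD('n) * (\<alpha> + \<beta> + c / R) ^ CARD('n)"
      using le unfolding eq power_mult_distrib by (simp only: mult_ac)
    then show ?case using elim(1) by simp
  qed
qed simp

end

section \<open>Minkowski arrangements of translates\<close>

lemma o_symmetric_body_exists:
  fixes K :: "(real ^ 'n) set"
  assumes "convex_body K" and sym: "symmetric_about 0 K"
  obtains c where "o_symmetric_body K c"
proof -
  have comp: "compact K" and conv: "convex K" and "interior K \<noteq> {}"
    using assms(1) by (auto simp: convex_body_def)
  have minus: "- x \<in> K" if "x \<in> K" for x
    using sym that by (auto simp: symmetric_about_def)
  obtain p r where r: "0 < r" "ball p r \<subseteq> K"
    using \<open>interior K \<noteq> {}\<close> by (meson all_not_in_conv mem_interior)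
  \<comment> \<open>By symmetry the ball about \<open>p\<close> has a mirror image about \<open>- p\<close>; midpoints of the two fill a
    ball about the origin.\<close>
  have ball: "x \<in> K" if "norm x < r" for x
  proof -
    have "p + x \<in> K" "p - x \<in> K" using r(2) that by (auto simp: subset_iff dist_norm)
    then have "(1/2) *\<^sub>R (p + x) + (1/2) *\<^sub>R (- (p - x)) \<in> K"
      using minus[of "p - x"] by (intro convexD[OF conv]) auto
    moreover have "(1/2) *\<^sub>R (p + x) + (1/2) *\<^sub>R (- (p - x)) = x"
      by (simp add: algebra_simps flip: scaleR_add_left)
    ultimately show ?thesis by simp
  qed
  define c where "c = (real CARD('n) + 1) / r"
  have c: "0 < c" using r(1) by (simp add: c_def)
  have "v \<in> (*\<^sub>R) c ` K" if v: "\<And>i. \<bar>v $ i\<bar> \<le> 1" for v :: "real ^ 'n"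
  proof -
    have "norm v \<le> (\<Sum>i\<in>UNIV. \<bar>v $ i\<bar>)" by (rule norm_le_l1_cart)
    also have "\<dots> \<le> real CARD('n)" using sum_mono[of UNIV "\<lambda>i. \<bar>v $ i\<bar>" "\<lambda>_. 1"] v by simp
    finally have "r * norm v < r * (real CARD('n) + 1)" using r(1) by simp
    then have "norm ((1 / c) *\<^sub>R v) < r"
      using c r(1) by (simp add: c_def field_simps)
    from ball[OF this] have "c *\<^sub>R ((1 / c) *\<^sub>R v) \<in> (*\<^sub>R) c ` K" by (rule imageI)
    then show ?thesis using c by simp
  qed
  then have "o_symmetric_body K c"
    using comp conv minus c by unfold_locales auto
  then show ?thesis by (rule that)
qed

lemma centered_representation:
  fixes K :: "(real ^ 'n) set"
  assumes "convex_body K" "centrally_symmetric K"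
  obtains p K0 where "convex_body K0" "symmetric_about 0 K0" "K = (\<lambda>x. x + p) ` K0"
proof -
  obtain p where p: "symmetric_about p K" using assms(2) by (auto simp: centrally_symmetric_def)
  have K: "K = (\<lambda>x. x + p) ` (\<lambda>x. x - p) ` K" by (simp add: image_image)
  moreover have "convex_body ((\<lambda>x. x - p) ` K)"
    using assms(1) interior_translation_subtract[of p K]
    by (auto simp: convex_body_def compact_translation_subtract convex_translation_subtract)
  moreover have "symmetric_about 0 ((\<lambda>x. x - p) ` K)"
    using symmetric_about_homothetic[OF p, of 1 "- p"] by simp
  ultimately show ?thesis using that by blast
qed

theorem theorem2:
  fixes K :: "(real ^ 'n) set" and F :: "(real ^ 'n) set set" and \<mu> :: real
  assumes "0 \<le> \<mu>" and "\<mu> \<le> 1"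
    and "convex_body K" and "centrally_symmetric K"
    and "intersecting_Minkowski_arrangement \<mu> K F"
    and "\<And>S. S \<in> F \<Longrightarrow> is_translate K S"
  shows "finite F \<and> real (card F) \<le> (1 + 2 / (1 + \<mu>)) ^ CARD('n)"
proof -
  obtain p K0 where K0: "convex_body K0" "symmetric_about 0 K0" and K: "K = (\<lambda>x. x + p) ` K0"
    using centered_representation[OF assms(3,4)] by blast
  obtain c where "o_symmetric_body K0 c" using o_symmetric_body_exists[OF K0] by blast
  then interpret o_symmetric_body K0 c .
  have "\<exists>t. S = (\<lambda>x. x + t) ` K0" if "S \<in> F" for S
  proof -
    have "is_translate K S" by (rule assms(6)[OF that])
    then obtain t where "S = (\<lambda>x. x + t) ` K" by (auto simp: is_translate_def)
    then have "S = (\<lambda>x. x + (p + t)) ` K0" by (simp add: K image_image add.assoc)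
    then show ?thesis by blast
  qed
  then obtain ctr where ctr: "\<And>S. S \<in> F \<Longrightarrow> S = (\<lambda>x. x + ctr S) ` K0" by metis
  have inj: "inj_on ctr F" using ctr by (metis inj_onI)
  have meet: "S \<inter> U \<noteq> {}" and apart: "interior S \<inter> mu_kernel \<mu> U = {}"
    if "S \<in> F" "U \<in> F" "S \<noteq> U" for S U
    using assms(5) that by (auto simp: intersecting_Minkowski_arrangement_def pairwise_def)
  have near: "ctr S - ctr U \<in> dil 2" if SU: "S \<in> F" "U \<in> F" for S U
  proof (cases "S = U")
    case True
    then show ?thesis using zero_in_K by (auto simp: image_iff)
  next
    case False
    then obtain y where yS: "y \<in> S" and yU: "y \<in> U" using meet[OF SU False] by blast
    have "y \<in> (\<lambda>x. x + ctr S) ` K0" by (rule subsetD[OF equalityD1[OF ctr[OF SU(1)]] yS])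
    moreover have "y \<in> (\<lambda>x. x + ctr U) ` K0"
      by (rule subsetD[OF equalityD1[OF ctr[OF SU(2)]] yU])
    ultimately obtain k l where kl: "k \<in> K0" "l \<in> K0" and y: "y = k + ctr S" "y = l + ctr U"
      by blast
    have "l - k \<in> dil (1 + 1)" using kl dil_diff[of l 1 k 1] by simp
    moreover have "ctr S - ctr U = l - k" using y by (simp add: algebra_simps)
    ultimately show ?thesis by simp
  qed
  have far: "ctr S - ctr U \<notin> (*\<^sub>R) (1 + \<mu>) ` interior K0" if SU: "S \<in> F" "U \<in> F" "S \<noteq> U" for S U
  proof
    assume "ctr S - ctr U \<in> (*\<^sub>R) (1 + \<mu>) ` interior K0"
    then obtain k where k: "k \<in> interior K0" "ctr S - ctr U = (1 + \<mu>) *\<^sub>R k" by blast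
    \<comment> \<open>The point \<open>ctr U + k = ctr S - \<mu> k\<close> lies in the interior of \<open>U\<close> and in the kernel of \<open>S\<close>.\<close>
    have "interior U = interior ((\<lambda>x. x + ctr U) ` K0)"
      by (rule arg_cong[OF ctr[OF SU(2)]])
    also have "\<dots> = (\<lambda>x. x + ctr U) ` interior K0"
      using interior_translation[of "ctr U" K0] by (simp add: add.commute)
    finally have "interior U = (\<lambda>x. x + ctr U) ` interior K0" .
    then have "k + ctr U \<in> interior U" using k(1) by blast
    moreover have "k + ctr U \<in> mu_kernel \<mu> S"
    proof -
      have "mu_kernel \<mu> S = mu_kernel \<mu> ((\<lambda>x. x + ctr S) ` K0)"
        by (rule arg_cong[OF ctr[OF SU(1)]])
      also have "\<dots> = (\<lambda>x. \<mu> *\<^sub>R x + ctr S) ` K0"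
        using mu_kernel_homothetic[OF compact_K _ K0(2), of \<mu> 1 "ctr S"] zero_in_K by auto
      finally have "mu_kernel \<mu> S = (\<lambda>x. \<mu> *\<^sub>R x + ctr S) ` K0" .
      moreover have "- k \<in> K0" using k(1) interior_subset minus_K by blast
      moreover have "k + ctr U = \<mu> *\<^sub>R (- k) + ctr S"
        using k(2) by (simp add: algebra_simps)
      ultimately show ?thesis by blast
    qed
    ultimately show False using apart[OF SU(2,1)] SU(3) by blast
  qed
  have bound: "real (card G) \<le> (1 + 2 / (1 + \<mu>)) ^ CARD('n)" if G: "G \<subseteq> F" "finite G" for G
  proof -
    have "card (ctr ` G) * (1 + \<mu>) ^ CARD('n) \<le> (1 + \<mu> + 2) ^ CARD('n)"
    proof (rule packing_bound)
      show "s - t \<notin> (*\<^sub>R) (1 + \<mu>) ` interior K0"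
        if "s \<in> ctr ` G" "t \<in> ctr ` G" "s \<noteq> t" for s t
        using far that G(1) by blast
    qed (use near G \<open>0 \<le> \<mu>\<close> in auto)
    moreover have "card (ctr ` G) = card G" using inj G(1) by (metis card_image inj_on_subset)
    moreover have "1 + 2 / (1 + \<mu>) = (1 + \<mu> + 2) / (1 + \<mu>)"
      using \<open>0 \<le> \<mu>\<close> by (simp add: field_simps)
    ultimately show ?thesis
      using \<open>0 \<le> \<mu>\<close> by (simp add: power_divide pos_le_divide_eq)
  qed
  then have "card G \<le> nat \<lfloor>(1 + 2 / (1 + \<mu>)) ^ CARD('n)\<rfloor>" if "G \<subseteq> F" "finite G" for G
    using that by (simp add: le_nat_floor)
  then have "finite F" using finite_if_finite_subsets_card_bdd by blast
  then show ?thesis using bound by blast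
qed

end
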